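(* Let $R$ be a finite commutative ring with unit whose order is a power of some prime number $p$, and let $S$ denote the set of all ideals of $R$. Then the generating function $$\mathrm{HD}(t):=\sum_{w\in\mathcal{D}(S)}\mathrm{rank}_{\mathbb{Z}}\bigl(\mathrm{Spl}_R(T(w))\bigr)\,t^{|E_{T(w)}|}$$ is algebraic, where $\mathrm{rank}_{\mathbb{Z}}(\mathrm{Spl}_R(T(w)))$ denotes the size of a $\mathbb{Z}$-basis of $\mathrm{Spl}_R(T(w))$.
   Context: For a module $M$ over a finite ring $R$, a $\mathbb{Z}$-basis of $M$ means a set of elements of smallest possible size that generates $M$ as a $\mathbb{Z}$-module (abelian group); so $\mathrm{rank}_{\mathbb{Z}}(M)$ is the minimal number of generators of $M$ as an abelian group. The Dyck language $\mathcal{D}(S)$ is the set of words (including the empty word) in the alphabet $\{(_\alpha,\,)_\alpha\mid\alpha\in S\}$ that are properly nested sequences of parentheses, each left parenthesis being closed by a right parenthesis with the same label. For $w\in\mathcal{D}(S)$ the planar rooted tree $T(w)$ with edge-labels in $S$ is defined recursively: the empty word gives the one-vertex tree; if $w=(_{\alpha_1}w_1)_{\alpha_1}\cdots(_{\alpha_m}w_m)_{\alpha_m}$ with $w_i\in\mathcal{D}(S)$, then $T(w)$ has $m$ edges out of its root, labeled $\alpha_1,\dots,\alpha_m$ from left to right, the $i$-th one attached to the root of $T(w_i)$. This is a bijection between $\mathcal{D}(S)$ and planar rooted trees with edge-labels in $S$; $|E_{T(w)}|$, the number of edges of $T(w)$, is half the length of $w$. For a tree $T$ with vertex set $V_T$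 and edges labeled by ideals of $R$ via $\alpha$, $\mathrm{Spl}_R(T)$ is the $R$-module of all $\mathbf p\in\bigoplus_{v\in V_T}R$ with $\mathbf p_u-\mathbf p_v\in\alpha(e)$ for each edge $e$ with endpoints $u,v$. A formal power series $F(t)$ is algebraic if there is a nonzero polynomial $P(x,t)$ with rational coefficients such that $P(F(t),t)=0$. *)

theory Defs
  imports
    "HOL-Algebra.Module"
    "HOL-Algebra.Ideal"
    "HOL-Algebra.Generated_Groups"
    "HOL-Computational_Algebra.Polynomial_FPS"
    "HOL-Computational_Algebra.Primes"
begin

datatype 'l paren = Open 'l | Close 'l

inductive_set dyck :: "'l set \<Rightarrow> 'l paren list set" for S :: "'l set" where
  Nil: "[] \<in> dyck S"
| Cons: "\<alpha> \<in> S \<Longrightarrow> w \<in> dyck S \<Longrightarrow> w' \<in> dyck S \<Longrightarrow> Open \<alpha> # w @ Close \<alpha> # w' \<in> dyck S"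

text \<open>The list of children, each with the label of the edge leading to it, is ordered from
  left to right.\<close>
datatype 'l ptree = Node "('l \<times> 'l ptree) list"

text \<open>The entries of \<open>cs\<close> are the triples of a label, the word enclosed by the
  corresponding pair of parentheses, and the tree of that word.\<close>
inductive tree_of_word :: "'l paren list \<Rightarrow> 'l ptree \<Rightarrow> bool" where
  "(\<forall>(\<alpha>, w, t) \<in> set cs. tree_of_word w t) \<Longrightarrow>
   tree_of_word (concat (map (\<lambda>(\<alpha>, w, t). Open \<alpha> # w @ [Close \<alpha>]) cs))
                (Node (map (\<lambda>(\<alpha>, w, t). (\<alpha>, t)) cs))"

definition dyck_tree :: "'l paren list \<Rightarrow> 'l ptree" where
  "dyck_tree w = (THE t. tree_of_word w t)"

context
begin

private fun step :: "'l paren \<Rightarrow> ('l \<times> 'l ptree) list list \<Rightarrow> ('l \<times> 'l ptree) list list" where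
  "step (Close \<alpha>) st = [] # st"
| "step (Open \<alpha>) (f # g # st) = ((\<alpha>, Node f) # g) # st"
| "step (Open \<alpha>) st = st"

private lemma foldr_step:
  "tree_of_word w t \<Longrightarrow> \<exists>ts. t = Node ts \<and> (\<forall>f st. foldr step w (f # st) = (ts @ f) # st)"
proof (induction rule: tree_of_word.induct)
  case (1 cs)
  then have "foldr step (concat (map (\<lambda>(\<alpha>, w, t). Open \<alpha> # w @ [Close \<alpha>]) cs)) (f # st)
               = (map (\<lambda>(\<alpha>, w, t). (\<alpha>, t)) cs @ f) # st" for f st
    by (induction cs) force+
  then show ?case by blast
qed

lemma tree_of_word_unique: "tree_of_word w t \<Longrightarrow> tree_of_word w t' \<Longrightarrow> t = t'"
  using foldr_step[of w t] foldr_step[of w t'] by force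

end

lemma tree_of_word_exists: "w \<in> dyck S \<Longrightarrow> \<exists>t. tree_of_word w t"
proof (induction rule: dyck.induct)
  case Nil
  show ?case using tree_of_word.intros[of "[]"] by auto
next
  case (Cons \<alpha> w w')
  then obtain t t' where t: "tree_of_word w t" "tree_of_word w' t'" by blast
  from t(2) obtain cs where cs: "\<forall>(\<alpha>, w, t) \<in> set cs. tree_of_word w t"
    "w' = concat (map (\<lambda>(\<alpha>, w, t). Open \<alpha> # w @ [Close \<alpha>]) cs)"
    by (cases rule: tree_of_word.cases) auto
  show ?case using tree_of_word.intros[of "(\<alpha>, w, t) # cs"] t(1) cs by auto
qed

lemma dyck_tree_eq: "tree_of_word w t \<Longrightarrow> dyck_tree w = t"
  unfolding dyck_tree_def using tree_of_word_unique by blast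

lemma tree_of_word_dyck_tree: "w \<in> dyck S \<Longrightarrow> tree_of_word w (dyck_tree w)"
  using tree_of_word_exists dyck_tree_eq by metis

lemma dyck_tree_concat:
  assumes "\<forall>(\<alpha>, w) \<in> set ws. w \<in> dyck S"
  shows "dyck_tree (concat (map (\<lambda>(\<alpha>, w). Open \<alpha> # w @ [Close \<alpha>]) ws)) =
           Node (map (\<lambda>(\<alpha>, w). (\<alpha>, dyck_tree w)) ws)"
proof -
  let ?cs = "map (\<lambda>(\<alpha>, w). (\<alpha>, w, dyck_tree w)) ws"
  have "\<forall>(\<alpha>, w, t) \<in> set ?cs. tree_of_word w t"
    using assms tree_of_word_dyck_tree by fastforce
  from dyck_tree_eq[OF tree_of_word.intros[OF this]] show ?thesis
    by (simp add: comp_def case_prod_unfold)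
qed

lemma size_child [termination_simp]:
  "i < length ts \<Longrightarrow> size (snd (ts ! i)) < Suc (size_list (\<lambda>x. Suc (size (snd x))) ts)"
  by (simp add: size_list_estimation'[OF nth_mem] less_Suc_eq_le)

text \<open>A vertex is addressed by the path of child indices leading to it from the root.\<close>
fun verts :: "'l ptree \<Rightarrow> nat list set" where
  "verts (Node ts) = insert [] (\<Union>i<length ts. (#) i ` verts (snd (ts ! i)))"

text \<open>An edge is recorded as (upper endpoint, label, lower endpoint).\<close>
fun edges :: "'l ptree \<Rightarrow> (nat list \<times> 'l \<times> nat list) set" where
  "edges (Node ts) =
     (\<Union>i<length ts. insert ([], fst (ts ! i), [i])
        ((\<lambda>(u, \<alpha>, v). (i # u, \<alpha>, i # v)) ` edges (snd (ts ! i))))"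

lemma finite_edges: "finite (edges t)"
  by (induction t rule: edges.induct) auto

lemma card_edges: "card (edges (Node ts)) = (\<Sum>(\<alpha>, t)\<leftarrow>ts. Suc (card (edges t)))"
proof -
  let ?g = "\<lambda>i::nat. \<lambda>(u, \<alpha> :: 'a, v). (i # u, \<alpha>, i # v)"
  let ?E = "\<lambda>i. insert ([], fst (ts ! i), [i]) (?g i ` edges (snd (ts ! i)))"
  have "inj (?g i)" for i by (auto simp: inj_def)
  then have 1: "card (?E i) = Suc (card (edges (snd (ts ! i))))" for i
    by (subst card_insert_disjoint)
       (auto simp: finite_edges intro: card_image inj_on_subset)
  have "card (edges (Node ts)) = (\<Sum>i<length ts. card (?E i))"
    unfolding edges.simps by (intro card_UN_disjoint) (auto simp: finite_edges)
  also have "\<dots> = (\<Sum>(\<alpha>, t)\<leftarrow>ts. Suc (card (edges t)))"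
    by (simp only: 1 sum_list_sum_nth)
       (simp add: case_prod_unfold lessThan_atLeast0)
  finally show ?thesis .
qed

lemma length_tree_of_word: "tree_of_word w t \<Longrightarrow> length w = 2 * card (edges t)"
proof (induction rule: tree_of_word.induct)
  case (1 cs)
  then show ?case unfolding card_edges by (induction cs) auto
qed

lemma length_dyck: "w \<in> dyck S \<Longrightarrow> length w = 2 * card (edges (dyck_tree w))"
  using length_tree_of_word tree_of_word_dyck_tree by blast

lemma finite_dyck:
  assumes "finite S"
  shows "finite {w \<in> dyck S. card (edges (dyck_tree w)) = n}"
proof (rule finite_subset)
  have "set w \<subseteq> Open ` S \<union> Close ` S" if "w \<in> dyck S" for w
    using that by induction auto
  then show "{w \<in> dyck S. card (edges (dyck_tree w)) = n}
    \<subseteq> {w. set w \<subseteq> Open ` S \<union> Close ` S \<and> length w = 2 * n}"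
    using length_dyck by blast
  show "finite {w. set w \<subseteq> Open ` S \<union> Close ` S \<and> length w = 2 * n}"
    using assms by (intro finite_lists_length_eq) auto
qed

text \<open>The module record of HOL-Algebra extends the ring record, so a multiplication and a unit
  have to be supplied; the pointwise ones are used.\<close>
definition Spl :: "('a, 'm) ring_scheme \<Rightarrow> 'a set ptree \<Rightarrow> ('a, nat list \<Rightarrow> 'a) module" where
  "Spl R T =
    \<lparr>carrier = {p \<in> verts T \<rightarrow>\<^sub>E carrier R. \<forall>(u, I, v) \<in> edges T. p u \<ominus>\<^bsub>R\<^esub> p v \<in> I},
     monoid.mult = (\<lambda>p q. \<lambda>v\<in>verts T. p v \<otimes>\<^bsub>R\<^esub> q v),
     one = (\<lambda>v\<in>verts T. \<one>\<^bsub>R\<^esub>),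
     zero = (\<lambda>v\<in>verts T. \<zero>\<^bsub>R\<^esub>),
     add = (\<lambda>p q. \<lambda>v\<in>verts T. p v \<oplus>\<^bsub>R\<^esub> q v),
     module.smult = (\<lambda>r p. \<lambda>v\<in>verts T. r \<otimes>\<^bsub>R\<^esub> p v)\<rparr>"

lemma edges_verts: "(u, I, v) \<in> edges T \<Longrightarrow> u \<in> verts T \<and> v \<in> verts T"
proof (induction T arbitrary: u v rule: edges.induct)
  case (1 ts)
  have "[] \<in> verts t" for t :: "'a ptree" by (cases t) simp
  with 1 show ?case by fastforce
qed

lemma Spl_module:
  fixes R (structure)
  assumes "cring R" and "\<And>u I v. (u, I, v) \<in> edges T \<Longrightarrow> ideal I R"
  shows "Module.module R (Spl R T)"
proof -
  interpret cring R by fact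
  let ?M = "Spl R T"
  note simps = Spl_def PiE_iff
  have in_I: "p u \<ominus> p v \<in> I" "ideal I R" "p u \<in> carrier R" "p v \<in> carrier R"
      "u \<in> verts T" "v \<in> verts T"
    if "p \<in> carrier ?M" "(u, I, v) \<in> edges T" for p u I v
    using that assms(2) edges_verts[OF that(2)] by (auto simp: simps)
  have add_closed: "p \<oplus>\<^bsub>?M\<^esub> q \<in> carrier ?M"
    if pq: "p \<in> carrier ?M" "q \<in> carrier ?M" for p q
  proof -
    have "(p u \<oplus> q u) \<ominus> (p v \<oplus> q v) \<in> I" if e: "(u, I, v) \<in> edges T" for u I v
    proof -
      interpret I: ideal I R using in_I[OF pq(1) e] by blast
      have "(p u \<oplus> q u) \<ominus> (p v \<oplus> q v) = (p u \<ominus> p v) \<oplus> (q u \<ominus> q v)"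
        using in_I[OF pq(1) e] in_I[OF pq(2) e] by algebra
      then show ?thesis using in_I[OF pq(1) e] in_I[OF pq(2) e] by simp
    qed
    then show ?thesis using pq by (auto simp: simps dest: edges_verts)
  qed
  have smult_closed: "r \<odot>\<^bsub>?M\<^esub> p \<in> carrier ?M"
    if rp: "r \<in> carrier R" "p \<in> carrier ?M" for r p
  proof -
    have "(r \<otimes> p u) \<ominus> (r \<otimes> p v) \<in> I" if e: "(u, I, v) \<in> edges T" for u I v
    proof -
      interpret I: ideal I R using in_I[OF rp(2) e] by blast
      have "(r \<otimes> p u) \<ominus> (r \<otimes> p v) = r \<otimes> (p u \<ominus> p v)"
        using in_I[OF rp(2) e] rp(1) by algebra
      then show ?thesis using in_I[OF rp(2) e] rp(1) I.I_l_closed by simp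
    qed
    then show ?thesis using rp by (auto simp: simps dest: edges_verts)
  qed
  have zero_closed: "\<zero>\<^bsub>?M\<^esub> \<in> carrier ?M"
  proof -
    have "\<zero> \<ominus> \<zero> \<in> I" if "(u, I, v) \<in> edges T" for u I v
      using assms(2)[OF that] additive_subgroup.zero_closed[OF ideal.axioms(1)]
      by (simp add: minus_eq)
    then show ?thesis by (auto simp: simps dest: edges_verts)
  qed
  have neg: "\<exists>q \<in> carrier ?M. q \<oplus>\<^bsub>?M\<^esub> p = \<zero>\<^bsub>?M\<^esub>" if p: "p \<in> carrier ?M" for p
  proof
    show "(\<ominus> \<one>) \<odot>\<^bsub>?M\<^esub> p \<in> carrier ?M" using smult_closed p by simp
    show "((\<ominus> \<one>) \<odot>\<^bsub>?M\<^esub> p) \<oplus>\<^bsub>?M\<^esub> p = \<zero>\<^bsub>?M\<^esub>"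
      using p by (auto simp: simps fun_eq_iff l_minus l_neg)
  qed
  show ?thesis
  proof (rule Module.moduleI)
    show "abelian_group ?M"
      using add_closed zero_closed neg
      by (intro abelian_groupI)
         (auto simp: simps extensional_def fun_eq_iff a_assoc intro: a_comm)
  qed (use smult_closed in \<open>auto simp: is_cring simps extensional_def fun_eq_iff
         l_distr r_distr m_assoc\<close>)
qed

definition rank_Z :: "('c, 'm) ring_scheme \<Rightarrow> nat" where
  "rank_Z M = (LEAST n. \<exists>B \<subseteq> carrier M. finite B \<and> card B = n \<and>
                          generate (add_monoid M) B = carrier M)"

text \<open>For finite \<open>R\<close> the sums are finite by \<open>finite_dyck\<close>.\<close>
definition HD :: "('a, 'm) ring_scheme \<Rightarrow> rat fps" where
  "HD R = Abs_fps (\<lambda>n. \<Sum>w | w \<in> dyck {I. ideal I R} \<and> card (edges (dyck_tree w)) = n.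
                         of_nat (rank_Z (Spl R (dyck_tree w))))"

text \<open>\<open>P\<close> is a polynomial in \<open>x\<close> whose coefficients are polynomials in \<open>t\<close>.\<close>
definition algebraic_fps :: "rat fps \<Rightarrow> bool" where
  "algebraic_fps F \<longleftrightarrow> (\<exists>P :: rat poly poly. P \<noteq> 0 \<and> poly (map_poly fps_of_poly P) F = 0)"

end

theory Submission
  imports Defs "HOL-Algebra.Multiplicative_Group"
begin

text \<open>Since \<open>T\<close> is a tree, an element of \<open>Spl R T\<close> is given by its value at the root and,
  independently for each edge \<open>e\<close>, by its difference along \<open>e\<close>, an element of \<open>\<alpha>(e)\<close>. The rank of a
  finite abelian \<open>p\<close>-group is the dimension of its \<open>p\<close>-torsion, so the rank of \<open>Spl R (T w)\<close> is
  \<open>d + (\<Sum>e. c(\<alpha>(e)))\<close>, where \<open>K\<close> is the \<open>p\<close>-torsion of \<open>R\<close>, \<open>p ^ d = card K\<close> and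
  \<open>p ^ c(I) = card (I \<inter> K)\<close>. With \<open>s\<close> the number of ideals and \<open>C\<close> the sum of all \<open>c(I)\<close>,
  writing a nonempty Dyck word as \<open>(\<^sub>\<alpha> w )\<^sub>\<alpha> w'\<close> gives \<open>D = 1 + s t D\<^sup>2\<close> for the counting series
  and \<open>E = C t D\<^sup>2 + 2 s t D E\<close> for the series of \<open>\<Sum>e. c(\<alpha>(e))\<close>; hence \<open>HD = d D + E\<close> is quadratic
  over the rational functions in \<open>t\<close>.\<close>

section \<open>Edge-constrained labelings of the vertices of a tree\<close>

text \<open>Taken over an arbitrary value set \<open>A\<close> so that the spline module and its
  p-torsion are counted by one argument.\<close>

definition labelings :: "'b set \<Rightarrow> ('l \<Rightarrow> 'b \<Rightarrow> 'b \<Rightarrow> bool) \<Rightarrow> 'l ptree \<Rightarrow> (nat list \<Rightarrow> 'b) set" where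
  "labelings A Q t = {x \<in> verts t \<rightarrow>\<^sub>E A. \<forall>(u, \<alpha>, v) \<in> edges t. Q \<alpha> (x u) (x v)}"

lemma Nil_in_verts: "[] \<in> verts t"
  by (cases t) simp

lemma finite_verts: "finite (verts t)"
  by (induction t rule: verts.induct) auto

lemma finite_labelings: "finite A \<Longrightarrow> finite (labelings A Q t)"
  unfolding labelings_def by (rule finite_subset[OF _ finite_PiE[OF finite_verts]]) auto

text \<open>With the root value fixed, no edge links two different branches, so a labeling is an
  independent choice for each child, whose own value must be compatible with
  \<open>r\<close>.\<close>

lemma bij_betw_labelings_Node:
  fixes Q :: "'l \<Rightarrow> 'b \<Rightarrow> 'b \<Rightarrow> bool"
  assumes "r \<in> A"
  shows "bij_betw (\<lambda>x. \<lambda>i\<in>{..<length ts}. \<lambda>v\<in>verts (snd (ts ! i)). x (i # v))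
    {x \<in> labelings A Q (Node ts). x [] = r}
    (\<Pi>\<^sub>E i\<in>{..<length ts}. {y \<in> labelings A Q (snd (ts ! i)). Q (fst (ts ! i)) r (y [])})"
    (is "bij_betw ?f ?X ?Y")
proof (rule bij_betw_byWitness)
  \<comment> \<open>The inverse glues the branches below the root: the path \<open>i # u\<close>
    leads to vertex \<open>u\<close> of branch \<open>i\<close>.\<close>
  define g where "g = (\<lambda>y :: nat \<Rightarrow> nat list \<Rightarrow> 'b. \<lambda>v\<in>verts (Node ts).
    case v of [] \<Rightarrow> r | i # u \<Rightarrow> y i u)"
  have v: "i < length ts \<Longrightarrow> u \<in> verts (snd (ts ! i)) \<Longrightarrow> i # u \<in> verts (Node ts)" for i u
    by auto
  show "\<forall>x\<in>?X. g (?f x) = x"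
  proof
    fix x assume x: "x \<in> ?X"
    show "g (?f x) = x"
    proof
      fix v show "g (?f x) v = x v"
        using x by (cases v) (auto simp: g_def labelings_def PiE_iff extensional_def image_iff)
    qed
  qed
  show "\<forall>y\<in>?Y. ?f (g y) = y"
  proof
    fix y assume y: "y \<in> ?Y"
    have "?f (g y) i = y i" for i
    proof (cases "i < length ts")
      case True
      then have yi: "y i \<in> extensional (verts (snd (ts ! i)))"
        using y by (auto simp: PiE_iff labelings_def)
      have "?f (g y) i u = y i u" for u
        using True yi by (auto simp: g_def v extensional_def)
      then show ?thesis by blast
    next
      case False
      then show ?thesis using y by (auto simp: PiE_iff extensional_def)
    qed
    then show "?f (g y) = y" by blast
  qed
  show "?f ` ?X \<subseteq> ?Y"
  proof (rule image_subsetI)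
    fix x assume x: "x \<in> ?X"
    show "?f x \<in> ?Y"
    proof (rule PiE_I)
      fix i assume i: "i \<in> {..<length ts}"
      have A: "x (i # u) \<in> A" if "u \<in> verts (snd (ts ! i))" for u
        using x v[of i u] i that by (auto simp: labelings_def PiE_iff)
      have "Q (fst (ts ! i)) r (x [i])"
        using x i by (force simp: labelings_def)
      moreover have "Q \<alpha> (x (i # u)) (x (i # w))" if "(u, \<alpha>, w) \<in> edges (snd (ts ! i))" for u \<alpha> w
        using x i that by (force simp: labelings_def)
      ultimately show "?f x i \<in> {y \<in> labelings A Q (snd (ts ! i)). Q (fst (ts ! i)) r (y [])}"
        using i A by (auto simp: labelings_def Nil_in_verts dest: edges_verts)
    qed auto
  qed
  show "g ` ?Y \<subseteq> ?X"
  proof (rule image_subsetI)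
    fix y assume y: "y \<in> ?Y"
    then have yi: "y i \<in> labelings A Q (snd (ts ! i))" "Q (fst (ts ! i)) r (y i [])"
      if "i < length ts" for i using that by (auto simp: PiE_iff)
    have Nil: "g y [] = r" by (simp add: g_def)
    have Cons: "g y (i # u) = y i u" if "i < length ts" "u \<in> verts (snd (ts ! i))" for i u
      using that by (auto simp: g_def)
    have "g y w \<in> A" if "w \<in> verts (Node ts)" for w
      using that assms yi Nil Cons by (auto simp: labelings_def PiE_iff)
    moreover have "g y \<in> extensional (verts (Node ts))" by (simp add: g_def)
    moreover have "Q \<alpha> (g y u) (g y w)" if "(u, \<alpha>, w) \<in> edges (Node ts)" for u \<alpha> w
    proof -
      from that obtain i where i: "i < length ts"
        "u = [] \<and> \<alpha> = fst (ts ! i) \<and> w = [i] \<or>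
         (\<exists>u' w'. u = i # u' \<and> w = i # w' \<and> (u', \<alpha>, w') \<in> edges (snd (ts ! i)))"
        by auto
      from i(2) show ?thesis
      proof (elim disjE conjE exE)
        fix u' w' assume "u = i # u'" "w = i # w'" and e: "(u', \<alpha>, w') \<in> edges (snd (ts ! i))"
        moreover have "Q \<alpha> (y i u') (y i w')" using yi(1)[OF i(1)] e by (auto simp: labelings_def)
        ultimately show ?thesis using Cons[OF i(1)] edges_verts[OF e] by simp
      qed (use yi(2)[OF i(1)] Nil Cons[OF i(1) Nil_in_verts] in simp)
    qed
    ultimately show "g y \<in> ?X"
      using Nil by (auto simp: labelings_def PiE_iff simp del: verts.simps edges.simps)
  qed
qed

text \<open>Each edge of the tree of a Dyck word comes from one opening parenthesis, so this is the
  sum of \<open>c\<close> over the edge labels.\<close>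

definition open_weight :: "('l \<Rightarrow> 'a::comm_monoid_add) \<Rightarrow> 'l paren list \<Rightarrow> 'a" where
  "open_weight c w = (\<Sum>x\<leftarrow>w. case x of Open \<alpha> \<Rightarrow> c \<alpha> | Close \<alpha> \<Rightarrow> 0)"

lemma open_weight_simps [simp]:
  "open_weight c [] = 0"
  "open_weight c (Open \<alpha> # w) = c \<alpha> + open_weight c w"
  "open_weight c (Close \<alpha> # w) = open_weight c w"
  "open_weight c (w @ w') = open_weight c w + open_weight c w'"
  by (simp_all add: open_weight_def)

lemma card_labelings_by_root:
  assumes "finite A"
  shows "card {x \<in> labelings A Q t. P (x [])} = (\<Sum>s | s \<in> A \<and> P s. card {x \<in> labelings A Q t. x [] = s})"
proof -
  have "{x \<in> labelings A Q t. P (x [])} = (\<Union>s\<in>{s \<in> A. P s}. {x \<in> labelings A Q t. x [] = s})"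
    using Nil_in_verts by (fastforce simp: labelings_def PiE_iff)
  then show ?thesis
    using assms by (simp only:) (intro card_UN_disjoint, auto simp: finite_labelings)
qed

text \<open>Crossing an edge downwards leaves \<open>p ^ c \<alpha>\<close> choices whatever the
  value above, and in a tree these choices multiply.\<close>

lemma card_labelings_root:
  assumes "tree_of_word w t" and "finite A"
    and "\<And>\<alpha> r. Open \<alpha> \<in> set w \<Longrightarrow> r \<in> A \<Longrightarrow> card {s \<in> A. Q \<alpha> r s} = p ^ c \<alpha>"
    and "r \<in> A"
  shows "card {x \<in> labelings A Q t. x [] = r} = p ^ open_weight c w"
  using assms(1,3,4)
proof (induction arbitrary: r rule: tree_of_word.induct)
  case (1 cs)
  let ?ts = "map (\<lambda>(\<alpha>, w, t). (\<alpha>, t)) cs"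
  let ?F = "\<lambda>(\<alpha>, t). {y \<in> labelings A Q t. Q \<alpha> r (y [])}"
  \<comment> \<open>The value at the child is chosen first; each of the
    \<open>p ^ c \<alpha>\<close> choices extends to the branch in the same number of ways, by the
    induction hypothesis.\<close>
  have F: "card (?F (\<alpha>, t)) = p ^ (c \<alpha> + open_weight c w)" if cs: "(\<alpha>, w, t) \<in> set cs" for \<alpha> w t
  proof -
    have "card {x \<in> labelings A Q t. x [] = s} = p ^ open_weight c w" if "s \<in> A" for s
      using 1(1,2) that cs by fastforce
    moreover have "card {s \<in> A. Q \<alpha> r s} = p ^ c \<alpha>"
      using 1(2)[of \<alpha> r] 1(3) cs by fastforce
    ultimately show ?thesis
      by (simp add: card_labelings_by_root[OF assms(2)] power_add)
  qed
  have "card {x \<in> labelings A Q (Node ?ts). x [] = r} = (\<Prod>i<length ?ts. card (?F (?ts ! i)))"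
    using bij_betw_same_card[OF bij_betw_labelings_Node[OF 1(3), where ts = ?ts and Q = Q]]
    by (simp add: card_PiE case_prod_unfold)
  also have "\<dots> = (\<Prod>u\<leftarrow>?ts. card (?F u))"
    by (simp add: prod.list_conv_set_nth lessThan_atLeast0)
  also have "\<dots> = (\<Prod>(\<alpha>, w, t)\<leftarrow>cs. p ^ (c \<alpha> + open_weight c w))"
    using F by (auto intro!: arg_cong[where f = prod_list])
  also have "\<dots> = p ^ open_weight c (concat (map (\<lambda>(\<alpha>, w, t). Open \<alpha> # w @ [Close \<alpha>]) cs))"
    by (induction cs) (auto simp: power_add)
  finally show ?case .
qed

lemma card_labelings:
  assumes "tree_of_word w t" and "finite A"
    and "\<And>\<alpha> r. Open \<alpha> \<in> set w \<Longrightarrow> r \<in> A \<Longrightarrow> card {s \<in> A. Q \<alpha> r s} = p ^ c \<alpha>"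
  shows "card (labelings A Q t) = card A * p ^ open_weight c w"
  using card_labelings_by_root[OF assms(2), where Q = Q and t = t and P = "\<lambda>_. True"]
    card_labelings_root[OF assms(1-3)] assms(3) by simp

section \<open>The rank of a finite abelian \<open>p\<close>-group\<close>

lemma (in comm_group) subgroup_pow_image: "subgroup ((\<lambda>x. x [^] (n::nat)) ` carrier G) G"
proof -
  interpret group_hom G G "\<lambda>x. x [^] n"
    by unfold_locales (simp add: hom_def nat_pow_distrib)
  show ?thesis by (rule img_is_subgroup)
qed

text \<open>The power map is an endomorphism, so all its nonempty fibres are translates of its
  kernel.\<close>

lemma (in comm_group) card_pow_image:
  assumes fin: "finite (carrier G)"
  shows "card (carrier G) =
    card ((\<lambda>x. x [^] (n::nat)) ` carrier G) * card {x \<in> carrier G. x [^] n = \<one>}"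
proof -
  have "card {x \<in> carrier G. x [^] n = z [^] n} = card {x \<in> carrier G. x [^] n = \<one>}"
    if z: "z \<in> carrier G" for z
  proof -
    have "bij_betw (\<lambda>x. inv z \<otimes> x) {x \<in> carrier G. x [^] n = z [^] n} {x \<in> carrier G. x [^] n = \<one>}"
      by (rule bij_betw_byWitness[where f' = "\<lambda>x. z \<otimes> x"])
         (use z in \<open>auto simp: nat_pow_distrib nat_pow_inv m_assoc[symmetric]\<close>)
    then show ?thesis by (rule bij_betw_same_card)
  qed
  then have "(\<Sum>y\<in>(\<lambda>x. x [^] n) ` carrier G. card {x \<in> carrier G. x [^] n = y}) =
      (\<Sum>y\<in>(\<lambda>x. x [^] n) ` carrier G. card {x \<in> carrier G. x [^] n = \<one>})"
    by (intro sum.cong) auto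
  then show ?thesis
    using sum.image_gen[OF fin, of "\<lambda>_. 1::nat" "\<lambda>x. x [^] n"] by simp
qed

lemma (in group) generate_Un_eq_imp_subset:
  assumes "generate G (H \<union> B) = carrier G" "H \<union> B \<subseteq> K" "subgroup K G"
  shows "K = carrier G"
  using generate_subgroup_incl[OF assms(2,3)] assms(1) subgroup.subset[OF assms(3)] by blast

text \<open>Greedy choice: enlarging a subgroup by an element outside it multiplies the order at
  least by \<open>p\<close>, because all subgroup orders are powers of \<open>p\<close>.\<close>

lemma (in group) generating_set_over_subgroup:
  assumes "Factorial_Ring.prime p" "Coset.order G = p ^ k" "subgroup H G"
  shows "\<exists>B\<subseteq>carrier G. finite B \<and> generate G (H \<union> B) = carrier G \<and>
           card H * p ^ card B \<le> card (carrier G)"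
  using assms(3)
proof (induction "card (carrier G) - card H" arbitrary: H rule: less_induct)
  case less
  have fin: "finite (carrier G)"
    using assms(1,2) prime_gt_0_nat by (intro order_gt_0_iff_finite[THEN iffD1]) auto
  interpret H: subgroup H G by fact
  show ?case
  proof (cases "H = carrier G")
    case True
    then have "generate G (H \<union> {}) = carrier G"
      using generate_incl[of H] generate.incl[of _ H G] H.subset by auto
    then show ?thesis using True by (intro exI[of _ "{}"]) auto
  next
    case False
    then obtain x where x: "x \<in> carrier G" "x \<notin> H" using H.subset by blast
    define H' where "H' = generate G (insert x H)"
    have H': "subgroup H' G" "insert x H \<subseteq> H'"
      unfolding H'_def using x H.subset by (auto intro: generate_is_subgroup generate.incl)
    have pow: "\<exists>i. card K = p ^ i" if "subgroup K G" for K
      using lagrange[OF that] divides_primepow_nat[OF assms(1), of "card K" k] assms(2)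
      by (metis dvd_triv_right)
    obtain i j where ij: "card H = p ^ i" "card H' = p ^ j"
      using pow[OF less.prems] pow[OF H'(1)] by blast
    have fin': "finite H'" using H' fin subgroup.subset finite_subset by metis
    have lt: "card H < card H'" using H'(2) x(2) fin' by (intro psubset_card_mono) auto
    then have "i < j" using ij assms(1) prime_gt_1_nat by auto
    then have le: "p * card H \<le> card H'"
      using ij assms(1) prime_gt_0_nat[of p] by (simp flip: power_Suc add: power_increasing Suc_leI)
    have "card H' \<le> card (carrier G)"
      using H' fin subgroup.subset card_mono by metis
    then obtain B where B: "B \<subseteq> carrier G" "finite B" "generate G (H' \<union> B) = carrier G"
        "card H' * p ^ card B \<le> card (carrier G)"
      using less.hyps[of H'] lt H'(1) by (meson diff_less_mono2 less_le_trans)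
    have "H' \<union> B \<subseteq> generate G (H \<union> insert x B)"
      using mono_generate[of "insert x H" "H \<union> insert x B"] generate.incl[of _ "H \<union> insert x B" G]
      unfolding H'_def by auto
    moreover have "subgroup (generate G (H \<union> insert x B)) G"
      using B x H.subset by (intro generate_is_subgroup) auto
    ultimately have "generate G (H \<union> insert x B) = carrier G"
      using generate_Un_eq_imp_subset[OF B(3)] by blast
    moreover have "card H * p ^ card (insert x B) \<le> card (carrier G)"
    proof -
      have "card H * p ^ card (insert x B) \<le> card H * p ^ Suc (card B)"
        using assms(1) prime_gt_0_nat[of p] card_insert_le_m1
        by (intro mult_left_mono power_increasing) (auto simp: card_insert_if B(2))
      also have "\<dots> \<le> card H' * p ^ card B" using le by (simp add: mult.assoc[symmetric] mult.commute)
      finally show ?thesis using B(4) by linarith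
    qed
    ultimately show ?thesis using B(1,2) x by (intro exI[of _ "insert x B"]) auto
  qed
qed

text \<open>Nakayama's lemma for abelian groups of exponent dividing \<open>p ^ k\<close>, with the \<open>p\<close>-th powers
  in the role of the submodule to be dropped.\<close>
lemma (in comm_group) generate_drop_pow_image:
  assumes "\<And>x. x \<in> carrier G \<Longrightarrow> x [^] (p ^ k :: nat) = \<one>"
    and "B \<subseteq> carrier G"
    and "generate G ((\<lambda>x. x [^] p) ` carrier G \<union> B) = carrier G"
  shows "generate G B = carrier G"
proof -
  define H where "H = generate G B"
  define P where "P = (\<lambda>x. x [^] p) ` carrier G"
  have H: "subgroup H G" using assms(2) generate_is_subgroup H_def by blast
  have P: "subgroup P G" unfolding P_def by (rule subgroup_pow_image)
  note Hc = subgroup.mem_carrier[OF H]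
  have sub: "subgroup (H <#> P) G" using H P by (rule mult_subgroups)
  have "P \<union> B \<subseteq> H <#> P"
  proof safe
    fix x assume "x \<in> P"
    then show "x \<in> H <#> P"
      using subgroup.one_closed[OF H] subgroup.mem_carrier[OF P] by (force simp: set_mult_def)
  next
    fix x assume "x \<in> B"
    then show "x \<in> H <#> P"
      using subgroup.one_closed[OF P] assms(2) generate.incl[of x B G] by (force simp: set_mult_def H_def)
  qed
  then have HP: "H <#> P = carrier G"
    using generate_Un_eq_imp_subset[OF assms(3)[folded P_def]] sub by blast
  \<comment> \<open>Substituting \<open>y = h' \<otimes> z [^] p\<close>, available from
    \<open>HP\<close>, raises the exponent of the last factor from \<open>p ^ n\<close> to
    \<open>p ^ Suc n\<close>; at \<open>n = k\<close> that factor is trivial.\<close>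
  have "\<exists>h\<in>H. \<exists>y\<in>carrier G. x = h \<otimes> y [^] (p ^ n)" if "x \<in> carrier G" for x and n :: nat
  proof (induction n)
    case 0
    show ?case using that subgroup.one_closed[OF H] by force
  next
    case (Suc n)
    then obtain h y where hy: "h \<in> H" "y \<in> carrier G" "x = h \<otimes> y [^] (p ^ n)" by blast
    have "y \<in> H <#> P" using HP hy by simp
    then obtain h' z where h': "h' \<in> H" "z \<in> carrier G" "y = h' \<otimes> z [^] p"
      by (auto simp: set_mult_def P_def)
    have "x = (h \<otimes> h' [^] (p ^ n)) \<otimes> z [^] (p ^ Suc n)"
      using hy h' Hc by (simp add: nat_pow_distrib nat_pow_pow m_assoc)
    moreover have "h \<otimes> h' [^] (p ^ n) \<in> H"
      using hy h' subgroup.m_closed[OF H] subgroup_int_pow_closed[OF H, of h' "int (p ^ n)"]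
      by (simp only: int_pow_int)
    ultimately show ?case using h' by blast
  qed
  then have "carrier G \<subseteq> H" using assms(1) Hc by (metis r_one subsetI)
  then show ?thesis using subgroup.subset[OF H] H_def by blast
qed

text \<open>Yields the lower bound for generating sets: modulo p-th powers every element has order
  dividing \<open>p\<close>, so each new generator multiplies the order at most by
  \<open>p\<close>.\<close>

lemma (in comm_group) card_generate_le:
  assumes "finite (carrier G)" "p > 0" "finite B" "B \<subseteq> carrier G"
  shows "card (generate G ((\<lambda>x. x [^] p) ` carrier G \<union> B)) \<le>
           card ((\<lambda>x. x [^] (p::nat)) ` carrier G) * p ^ card B"
  using assms(3,4)
proof (induction rule: finite_induct)
  case empty
  have "generate G ((\<lambda>x. x [^] p) ` carrier G) \<subseteq> (\<lambda>x. x [^] p) ` carrier G"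
    by (rule generate_subgroup_incl[OF order_refl subgroup_pow_image])
  then show ?case using assms(1) by (auto intro: card_mono)
next
  case (insert b B)
  define P where "P = (\<lambda>x. x [^] p) ` carrier G"
  define H where "H = generate G (P \<union> B)"
  have PB: "P \<union> B \<subseteq> carrier G" unfolding P_def using insert.prems by auto
  have b: "b \<in> carrier G" using insert.prems by simp
  have H: "subgroup H G" unfolding H_def using PB by (rule generate_is_subgroup)
  have finH: "finite H" using assms(1) subgroup.subset[OF H] finite_subset by blast
  have gb: "subgroup (generate G {b}) G" using b by (intro generate_is_subgroup) auto
  have "P \<union> insert b B \<subseteq> generate G {b} <#> H"
  proof -
    have "b \<in> generate G {b} <#> H"
      using generate.incl[of b "{b}" G] subgroup.one_closed[OF H] b by (force simp: set_mult_def)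
    moreover have "P \<union> B \<subseteq> generate G {b} <#> H"
    proof
      fix x assume x: "x \<in> P \<union> B"
      then have "x \<in> H" unfolding H_def by (rule generate.incl)
      moreover have "x = \<one> \<otimes> x" using x PB by auto
      ultimately show "x \<in> generate G {b} <#> H"
        using subgroup.one_closed[OF gb] unfolding set_mult_def by blast
    qed
    ultimately show ?thesis by blast
  qed
  then have "generate G (P \<union> insert b B) \<subseteq> generate G {b} <#> H"
    by (rule generate_subgroup_incl[OF _ mult_subgroups[OF gb H]])
  \<comment> \<open>Division with remainder in the exponent of \<open>b\<close>: the multiple of
    \<open>p\<close> gives a p-th power, which is absorbed into \<open>H\<close>, and only the
    remainders \<open>0..<p\<close> are left.\<close>
  also have "\<dots> \<subseteq> (\<lambda>(i, h). b [^] i \<otimes> h) ` ({0..<int p} \<times> H)"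
  proof
    fix x assume "x \<in> generate G {b} <#> H"
    then obtain i :: int and h where ih: "x = b [^] i \<otimes> h" "h \<in> H"
      by (auto simp: set_mult_def generate_pow[OF b])
    let ?q = "i div int p"
    have "(b [^] ?q) [^] p \<in> P" unfolding P_def using b by blast
    then have h': "(b [^] ?q) [^] p \<otimes> h \<in> H"
      using ih subgroup.m_closed[OF H] generate.incl[of _ "P \<union> B" G] by (simp add: H_def)
    have "b [^] i = b [^] (i mod int p + ?q * int p)" by simp
    also have "\<dots> = b [^] (i mod int p) \<otimes> (b [^] ?q) [^] int p"
      by (simp only: int_pow_mult[OF b] int_pow_pow[OF b])
    finally have "x = b [^] (i mod int p) \<otimes> ((b [^] ?q) [^] p \<otimes> h)"
      using ih b subgroup.mem_carrier[OF H] by (simp add: m_assoc int_pow_int)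
    then show "x \<in> (\<lambda>(i, h). b [^] i \<otimes> h) ` ({0..<int p} \<times> H)"
      using h' assms(2) by (intro image_eqI[of _ _ "(i mod int p, (b [^] ?q) [^] p \<otimes> h)"]) auto
  qed
  finally have "card (generate G (P \<union> insert b B)) \<le> card ((\<lambda>(i, h). b [^] i \<otimes> h) ` ({0..<int p} \<times> H))"
    using finH by (intro card_mono) auto
  also have "\<dots> \<le> card ({0..<int p} \<times> H)" using finH by (intro card_image_le) auto
  also have "\<dots> = p * card H" by (simp add: card_cartesian_product)
  finally show ?case using insert P_def H_def by (simp add: algebra_simps)
     (meson le_trans mult_le_mono2)
qed

text \<open>The p-th powers have index \<open>p ^ d\<close> by \<open>card_pow_image\<close>, which
  bounds generating sets from below by \<open>card_generate_le\<close>. Conversely, at most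
  \<open>d\<close> elements generate the group together with the p-th powers, and these elements
  generate it alone by \<open>generate_drop_pow_image\<close>.\<close>

lemma (in comm_group) least_generating_set:
  assumes "Factorial_Ring.prime p" "Coset.order G = p ^ k"
    and "card {x \<in> carrier G. x [^] p = \<one>} = p ^ d"
  shows "(LEAST n. \<exists>B\<subseteq>carrier G. finite B \<and> card B = n \<and> generate G B = carrier G) = d"
proof -
  let ?P = "(\<lambda>x. x [^] p) ` carrier G"
  have p: "p > 1" using assms(1) prime_gt_1_nat by blast
  have fin: "finite (carrier G)"
    using assms(2) p by (intro order_gt_0_iff_finite[THEN iffD1]) auto
  have P: "card ?P > 0" using fin by (auto simp: card_gt_0_iff)
  have card: "card (carrier G) = card ?P * p ^ d"
    using card_pow_image[OF fin, of p] assms(3) by simp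
  have ge: "d \<le> card B" if B: "B \<subseteq> carrier G" "finite B" "generate G B = carrier G" for B
  proof -
    have "generate G B \<subseteq> generate G (?P \<union> B)" by (rule mono_generate) auto
    moreover have "generate G (?P \<union> B) \<subseteq> carrier G" using B by (intro generate_incl) auto
    ultimately have "card ?P * p ^ d \<le> card ?P * p ^ card B"
      using card_generate_le[OF fin _ B(2,1), of p] card p B(3) by auto
    then show ?thesis using P p by simp
  qed
  obtain B where B: "B \<subseteq> carrier G" "finite B" "generate G (?P \<union> B) = carrier G"
      "card ?P * p ^ card B \<le> card (carrier G)"
    using generating_set_over_subgroup[OF assms(1,2) subgroup_pow_image[of p]] by blast
  have "x [^] (p ^ k) = \<one>" if "x \<in> carrier G" for x
    using pow_order_eq_1[OF that] assms(2) by simp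
  then have gen: "generate G B = carrier G" using B(1,3) by (rule generate_drop_pow_image)
  have "card B = d" using B(4) card P p ge[OF B(1,2) gen] by (simp add: le_antisym)
  then show ?thesis
    using B gen ge by (intro Least_equality) blast+
qed

section \<open>Generating functions of Dyck words\<close>

unbundle fps_syntax

section \<open>First-return decomposition of Dyck words\<close>

lemma dyck_tree_Cons:
  assumes "w \<in> dyck S" "w' \<in> dyck S"
  shows "\<exists>ts. dyck_tree (Open \<alpha> # w @ Close \<alpha> # w') = Node ((\<alpha>, dyck_tree w) # ts)"
proof -
  from tree_of_word_dyck_tree[OF assms(2)] obtain cs
    where cs: "\<forall>(\<alpha>, w, t) \<in> set cs. tree_of_word w t"
      "w' = concat (map (\<lambda>(\<alpha>, w, t). Open \<alpha> # w @ [Close \<alpha>]) cs)"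
    by (cases rule: tree_of_word.cases) auto
  then show ?thesis
    using dyck_tree_eq[OF tree_of_word.intros[of "(\<alpha>, w, dyck_tree w) # cs"]]
      tree_of_word_dyck_tree[OF assms(1)] by auto
qed

text \<open>The tree determines its first branch, whose edge count fixes the length of the enclosed
  word and thus the place of the matching parenthesis.\<close>

lemma dyck_Cons_inject:
  assumes "w \<in> dyck S" "w' \<in> dyck S" "v \<in> dyck S" "v' \<in> dyck S"
    and "Open \<alpha> # w @ Close \<alpha> # w' = Open \<beta> # v @ Close \<beta> # v'"
  shows "\<alpha> = \<beta> \<and> w = v \<and> w' = v'"
proof -
  have "dyck_tree w = dyck_tree v"
    using dyck_tree_Cons[OF assms(1,2)] dyck_tree_Cons[OF assms(3,4)] assms(5)
    by (metis list.inject prod.inject ptree.inject)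
  then have "length w = length v" using length_dyck assms(1,3) by metis
  then show ?thesis using assms(5) by simp
qed

definition dyck_words :: "'l set \<Rightarrow> nat \<Rightarrow> 'l paren list set" where
  "dyck_words S n = {w \<in> dyck S. card (edges (dyck_tree w)) = n}"

lemma dyck_words_alt: "dyck_words S n = {w \<in> dyck S. length w = 2 * n}"
  unfolding dyck_words_def using length_dyck by fastforce

lemma dyck_words_0: "dyck_words S 0 = {[]}"
  by (auto simp: dyck_words_alt dyck.Nil)

text \<open>The outer pair accounts for the edge added by \<open>Suc\<close>; the other
  \<open>n\<close> edges split between the enclosed word and the rest. This is the source of the
  Cauchy products below.\<close>

lemma bij_betw_dyck_words_Suc:
  "bij_betw (\<lambda>(k, \<alpha>, w, w'). Open \<alpha> # w @ Close \<alpha> # w')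
     (SIGMA k:{0..n}. S \<times> dyck_words S k \<times> dyck_words S (n - k)) (dyck_words S (Suc n))"
  (is "bij_betw ?f ?X _")
  unfolding bij_betw_def
proof
  show "inj_on ?f ?X"
  proof (rule inj_onI)
    fix X Y assume XY: "X \<in> ?X" "Y \<in> ?X" "?f X = ?f Y"
    obtain k \<alpha> w w' l \<beta> v v' where X: "X = (k, \<alpha>, w, w')" and Y: "Y = (l, \<beta>, v, v')"
      by (cases X, cases Y)
    have *: "w \<in> dyck_words S k" "w' \<in> dyck_words S (n - k)"
      "v \<in> dyck_words S l" "v' \<in> dyck_words S (n - l)"
      and eq: "Open \<alpha> # w @ Close \<alpha> # w' = Open \<beta> # v @ Close \<beta> # v'"
      using XY by (auto simp: X Y)
    have "\<alpha> = \<beta> \<and> w = v \<and> w' = v'"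
      using * by (intro dyck_Cons_inject[OF _ _ _ _ eq, of S]) (auto simp: dyck_words_alt)
    then show "X = Y" using * by (auto simp: X Y dyck_words_alt)
  qed
  show "?f ` ?X = dyck_words S (Suc n)"
  proof
    show "?f ` ?X \<subseteq> dyck_words S (Suc n)"
      by (auto simp: dyck_words_alt intro: dyck.Cons)
    show "dyck_words S (Suc n) \<subseteq> ?f ` ?X"
    proof
      fix x assume "x \<in> dyck_words S (Suc n)"
      then have x: "x \<in> dyck S" "length x = 2 * Suc n" by (auto simp: dyck_words_alt)
      from x(1) show "x \<in> ?f ` ?X"
      proof cases
        case (Cons \<alpha> w w')
        have "even (length w)" "even (length w')" using length_dyck Cons by (metis dvd_triv_left)+
        then obtain k l where "length w = 2 * k" "length w' = 2 * l" by (metis dvdE)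
        moreover from this have "l = n - k" "k \<le> n" using x(2) Cons by auto
        ultimately show ?thesis using Cons
          by (intro image_eqI[of _ _ "(k, \<alpha>, w, w')"]) (auto simp: dyck_words_alt)
      qed (use x in simp)
    qed
  qed
qed

lemma finite_dyck_words: "finite S \<Longrightarrow> finite (dyck_words S n)"
  unfolding dyck_words_def by (rule finite_dyck)

lemma sum_dyck_words_Suc:
  fixes f :: "_ \<Rightarrow> 'b::comm_monoid_add"
  assumes "finite S"
  shows "(\<Sum>x\<in>dyck_words S (Suc n). f x) =
    (\<Sum>k=0..n. \<Sum>\<alpha>\<in>S. \<Sum>w\<in>dyck_words S k. \<Sum>w'\<in>dyck_words S (n - k).
       f (Open \<alpha> # w @ Close \<alpha> # w'))"
  using assms
  by (simp add: sum.reindex_bij_betw[OF bij_betw_dyck_words_Suc, symmetric] sum.Sigma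
      sum.cartesian_product finite_dyck_words case_prod_unfold)

section \<open>Functional equations of the generating series\<close>

definition dyck_fps :: "'l set \<Rightarrow> rat fps" where
  "dyck_fps S = Abs_fps (\<lambda>n. of_nat (card (dyck_words S n)))"

definition weight_fps :: "('l \<Rightarrow> nat) \<Rightarrow> 'l set \<Rightarrow> rat fps" where
  "weight_fps c S = Abs_fps (\<lambda>n. \<Sum>w\<in>dyck_words S n. of_nat (open_weight c w))"

lemma fps_of_nat_mult_nth: "(of_nat k * f) $ n = of_nat k * f $ n" for f :: "'a::comm_semiring_1 fps"
  by (simp flip: fps_of_nat)

lemma dyck_fps_eq:
  assumes "finite S"
  shows "dyck_fps S = 1 + of_nat (card S) * fps_X * dyck_fps S * dyck_fps S"
proof (rule fps_ext)
  fix n show "dyck_fps S $ n = (1 + of_nat (card S) * fps_X * dyck_fps S * dyck_fps S) $ n"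
  proof (cases n)
    case 0
    then show ?thesis by (simp add: dyck_fps_def dyck_words_0)
  next
    case (Suc m)
    have "dyck_fps S $ Suc m = (\<Sum>x\<in>dyck_words S (Suc m). 1)" by (simp add: dyck_fps_def)
    also have "\<dots> = of_nat (card S) * (dyck_fps S * dyck_fps S) $ m"
      unfolding sum_dyck_words_Suc[OF assms]
      by (simp add: fps_mult_nth dyck_fps_def sum_distrib_left)
    finally show ?thesis using Suc by (simp add: mult.assoc fps_of_nat_mult_nth)
  qed
qed

text \<open>The weight of \<open>Open \<alpha> # w @ Close \<alpha> # w'\<close> is
  \<open>c \<alpha>\<close> plus the weights of \<open>w\<close> and \<open>w'\<close>; the last two
  contribute equally, hence the factor 2.\<close>

lemma weight_fps_eq:
  assumes "finite S"
  shows "weight_fps c S = of_nat (\<Sum>\<alpha>\<in>S. c \<alpha>) * fps_X * dyck_fps S * dyck_fps S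
           + 2 * of_nat (card S) * fps_X * dyck_fps S * weight_fps c S"
proof -
  let ?D = "dyck_fps S" and ?E = "weight_fps c S" and ?C = "\<Sum>\<alpha>\<in>S. c \<alpha>"
  have "?E = fps_X * (of_nat ?C * (?D * ?D) + of_nat (card S) * (?E * ?D) + of_nat (card S) * (?D * ?E))"
  proof (rule fps_ext)
    fix n
    show "?E $ n = (fps_X * (of_nat ?C * (?D * ?D) + of_nat (card S) * (?E * ?D)
      + of_nat (card S) * (?D * ?E))) $ n"
    proof (cases n)
      case 0
      then show ?thesis by (simp add: weight_fps_def dyck_words_0)
    next
      case (Suc m)
      have "?E $ Suc m = (\<Sum>x\<in>dyck_words S (Suc m). of_nat (open_weight c x))"
        by (simp add: weight_fps_def)
      also have "\<dots> = (\<Sum>k=0..m. of_nat ?C * (?D $ k * ?D $ (m - k)) + of_nat (card S) * (?E $ k * ?D $ (m - k))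
          + of_nat (card S) * (?D $ k * ?E $ (m - k)))"
        unfolding sum_dyck_words_Suc[OF assms]
        by (simp add: dyck_fps_def weight_fps_def sum.distrib sum_distrib_left sum_distrib_right
              algebra_simps)
      also have "\<dots> = of_nat ?C * (?D * ?D) $ m + of_nat (card S) * (?E * ?D) $ m
          + of_nat (card S) * (?D * ?E) $ m"
        by (simp add: fps_mult_nth sum.distrib sum_distrib_left)
      finally show ?thesis
        by (simp only: Suc fps_X_mult_nth fps_add_nth fps_of_nat_mult_nth) simp
    qed
  qed
  then show ?thesis by (simp add: algebra_simps del: of_nat_sum)
qed

text \<open>Eliminates \<open>D\<close> and \<open>E\<close> in favour of \<open>k*D + E\<close>
  alone. Scaling by \<open>2*s\<^sup>2*t\<close> and multiplying by the square root avoid all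
  divisions, so the relation holds in any commutative ring; squaring then removes the root.\<close>

lemma quadratic_relation:
  fixes D E s t C k :: "'a::comm_ring_1"
  assumes D: "D = 1 + s * t * D * D" and E: "E = C * t * D * D + 2 * s * t * D * E"
  shows "(1 - 4*s*t) * (2*s\<^sup>2*t * (k*D + E) + (C - k*s))\<^sup>2 = (C * (1 - 2*s*t) - k*s * (1 - 4*s*t))\<^sup>2"
proof -
  \<comment> \<open>\<open>\<delta>\<close> is the square root of \<open>1 - 4st\<close> from the quadratic formula for \<open>D\<close>.\<close>
  define \<delta> where "\<delta> = 1 - 2*s*t*D"
  have st: "s * t * D * D = D - 1" using D by (metis add_diff_cancel_left')
  have "\<delta> * \<delta> = 1 - 4*s*t*D + 4*s*t * (s*t*D*D)" by (simp add: \<delta>_def algebra_simps)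
  also have "\<dots> = 1 - 4*s*t" unfolding st by (simp add: algebra_simps)
  finally have \<delta>2: "\<delta> * \<delta> = 1 - 4*s*t" .
  have "E * \<delta> = E - 2*s*t*D*E" by (simp add: \<delta>_def algebra_simps)
  also have "\<dots> = C * t * D * D" using E by (metis add_diff_cancel_right')
  finally have "s * (E * \<delta>) = C * (s*t*D*D)" by (simp add: algebra_simps)
  then have E\<delta>: "s * (E * \<delta>) = C * (D - 1)" unfolding st .
  have D\<delta>: "2*s*t*D = 1 - \<delta>" by (simp add: \<delta>_def)
  have "\<delta> * (2*s\<^sup>2*t * (k*D + E) + (C - k*s))
      = k*s*(2*s*t*D)*\<delta> + 2*s*t*(s*(E*\<delta>)) + C*\<delta> - k*s*\<delta>"
    by (simp add: power2_eq_square algebra_simps)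
  also have "\<dots> = k*s*(1-\<delta>)*\<delta> + C*(2*s*t*D) - 2*s*t*C + C*\<delta> - k*s*\<delta>"
    unfolding E\<delta> D\<delta>[symmetric] by (simp add: algebra_simps)
  also have "\<dots> = C * (1 - 2*s*t) - k*s*(\<delta>*\<delta>)" unfolding D\<delta> by (simp add: algebra_simps)
  finally have "\<delta> * (2*s\<^sup>2*t * (k*D + E) + (C - k*s)) = C * (1 - 2*s*t) - k*s * (1 - 4*s*t)"
    unfolding \<delta>2 .
  then show ?thesis unfolding \<delta>2[symmetric] by (metis power2_eq_square power_mult_distrib)
qed

lemma fps_of_poly_of_nat: "fps_of_poly (of_nat n) = of_nat n"
  by (induction n) (simp_all add: fps_of_poly_add)

lemma algebraic_fps_weight:
  assumes "finite S" "S \<noteq> {}"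
  shows "algebraic_fps (of_nat k * dyck_fps S + weight_fps c S)"
proof -
  define H where "H = of_nat k * dyck_fps S + weight_fps c S"
  define s C :: "rat poly" where "s = of_nat (card S)" and "C = of_nat (\<Sum>\<alpha>\<in>S. c \<alpha>)"
  define t K :: "rat poly" where "t = [:0, 1:]" and "K = of_nat k"
  define d e g where "d = 2*s\<^sup>2*t" and "e = C - K*s" and "g = C*(1 - 2*s*t) - K*s*(1 - 4*s*t)"
  \<comment> \<open>The expansion of \<open>(1 - 4*s*t) * (d*x + e)\<^sup>2 - g\<^sup>2\<close> in
    powers of \<open>x\<close>, which vanishes at \<open>H\<close> by
    \<open>quadratic_relation\<close>.\<close>
  define P where "P = [:(1 - 4*s*t)*e\<^sup>2 - g\<^sup>2, 2*(1 - 4*s*t)*d*e, (1 - 4*s*t)*d\<^sup>2:]"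
  have s: "s = [:of_nat (card S):]" "card S > 0"
    using assms by (simp_all add: s_def of_nat_poly card_gt_0_iff)
  \<comment> \<open>The leading coefficient is nonzero: \<open>1 - 4*s*t\<close> has constant term
    1, and \<open>d\<close> is nonzero because \<open>S\<close> is nonempty.\<close>
  have "poly.coeff P 2 = (1 - 4*s*t) * d\<^sup>2"
    by (simp add: P_def power2_eq_square numeral_2_eq_2)
  moreover have "poly (1 - 4*s*t) 0 = 1" by (simp add: t_def)
  then have "1 - 4*s*t \<noteq> 0" by force
  ultimately have "P \<noteq> 0" using s by (auto simp: t_def d_def)
  let ?F = fps_of_poly
  have "poly (map_poly ?F P) H = (1 - 4*?F s*?F t) * (?F d * H + ?F e)\<^sup>2 - (?F g)\<^sup>2"
    by (simp add: P_def map_poly_pCons fps_of_poly_simps power2_eq_square algebra_simps)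
  also have "\<dots> = 0"
    using quadratic_relation[OF dyck_fps_eq[OF assms(1)] weight_fps_eq[OF assms(1), of c], of "of_nat k"]
    by (simp add: H_def d_def e_def g_def s_def t_def C_def K_def fps_of_poly_simps fps_of_poly_of_nat)
  finally show ?thesis using \<open>P \<noteq> 0\<close> unfolding algebraic_fps_def H_def by blast
qed

section \<open>The rank of the spline module\<close>

text \<open>The number of values allowed across an edge is independent of the value at the other
  end, as \<open>card_labelings\<close> requires: the self-inverse map
  \<open>s \<mapsto> r \<ominus> s\<close> carries them onto \<open>I \<inter> K\<close>.\<close>

lemma (in ring) card_coset_Int:
  assumes "additive_subgroup K R" "additive_subgroup I R" "r \<in> K"
  shows "card {s \<in> K. r \<ominus> s \<in> I} = card (I \<inter> K)"
proof -
  interpret K: additive_subgroup K R by fact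
  interpret I: additive_subgroup I R by fact
  have m: "r \<ominus> s \<in> K" "r \<ominus> (r \<ominus> s) = s" if "s \<in> K" for s
    using that assms(3) K.a_Hcarr by (auto simp: minus_eq minus_add r_neg1 a_assoc[symmetric] r_neg)
  have "bij_betw (\<lambda>s. r \<ominus> s) {s \<in> K. r \<ominus> s \<in> I} (I \<inter> K)"
    by (rule bij_betw_byWitness[where f' = "\<lambda>s. r \<ominus> s"]) (auto simp: m)
  then show ?thesis by (rule bij_betw_same_card)
qed

section \<open>The spline module and its torsion as sets of labelings\<close>

lemma Spl_carrier: "carrier (Spl R T) = labelings (carrier R) (\<lambda>I a b. a \<ominus>\<^bsub>R\<^esub> b \<in> I) T"
  by (simp add: Spl_def labelings_def)

lemma Spl_add_pow:
  "pow (add_monoid (Spl R T)) x (n::nat) = (\<lambda>v\<in>verts T. [n] \<cdot>\<^bsub>R\<^esub> x v)"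
  by (induction n) (auto simp: nat_pow_def add_pow_def Spl_def)

lemma (in ring) torsion_additive_subgroup:
  "additive_subgroup {r \<in> carrier R. [n] \<cdot> r = \<zero>} R" for n :: nat
proof (rule additive_subgroupI, rule add.subgroupI)
  show "{r \<in> carrier R. [n] \<cdot> r = \<zero>} \<noteq> {}" by (auto intro: add.nat_pow_one)
qed (auto simp: add.nat_pow_inv add.nat_pow_distrib)

text \<open>Multiples are taken vertex by vertex, so torsion restricts the values but leaves the
  edge conditions unchanged, and the same count applies.\<close>

lemma (in ring) Spl_torsion:
  "{x \<in> carrier (Spl R T). pow (add_monoid (Spl R T)) x n = \<one>\<^bsub>add_monoid (Spl R T)\<^esub>} =
     labelings {r \<in> carrier R. [n] \<cdot> r = \<zero>} (\<lambda>I a b. a \<ominus> b \<in> I) T" for n :: nat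
proof -
  have "pow (add_monoid (Spl R T)) x n = \<one>\<^bsub>add_monoid (Spl R T)\<^esub> \<longleftrightarrow> (\<forall>v\<in>verts T. [n] \<cdot> x v = \<zero>)" for x
    unfolding Spl_add_pow by (auto simp: Spl_def restrict_def fun_eq_iff)
  then show ?thesis by (auto simp: Spl_carrier labelings_def PiE_iff)
qed

lemma dyck_Open_mem: "w \<in> dyck S \<Longrightarrow> Open \<alpha> \<in> set w \<Longrightarrow> \<alpha> \<in> S"
  by (induction rule: dyck.induct) auto

lemma edges_tree_of_word_Open:
  "tree_of_word w t \<Longrightarrow> (u, \<alpha>, v) \<in> edges t \<Longrightarrow> Open \<alpha> \<in> set w"
proof (induction arbitrary: u v rule: tree_of_word.induct)
  case (1 cs)
  then obtain i where i: "i < length cs"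
    "\<alpha> = fst (cs ! i) \<or> (\<exists>u v. (u, \<alpha>, v) \<in> edges (snd (snd (cs ! i))))"
    by (auto simp: case_prod_unfold) blast+
  obtain \<beta> w t where c: "cs ! i = (\<beta>, w, t)" by (cases "cs ! i")
  then have mem: "(\<beta>, w, t) \<in> set cs" using i(1) by (metis nth_mem)
  have "\<alpha> = \<beta> \<or> Open \<alpha> \<in> set w"
    using i(2) 1 mem unfolding c by auto
  then show ?case using mem by force
qed

text \<open>Guarantees that the edge labels are ideals, as \<open>Spl_module\<close>
  demands.\<close>

lemma edges_dyck_tree_mem:
  "w \<in> dyck S \<Longrightarrow> (u, \<alpha>, v) \<in> edges (dyck_tree w) \<Longrightarrow> \<alpha> \<in> S"
  using edges_tree_of_word_Open tree_of_word_dyck_tree dyck_Open_mem by metis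

text \<open>The rank is the exponent of the order of the p-torsion,
  \<open>card K * p ^ open_weight c w\<close>; \<open>d\<close> and \<open>c\<close> depend on
  \<open>R\<close> and \<open>p\<close> but not on the word.\<close>

lemma (in cring) rank_Spl:
  assumes p: "Factorial_Ring.prime p" and k: "Coset.order R = p ^ k"
  shows "\<exists>d c. \<forall>w \<in> dyck {I. ideal I R}. rank_Z (Spl R (dyck_tree w)) = d + open_weight c w"
proof -
  have fin: "finite (carrier R)"
    using p k prime_gt_0_nat[of p] by (intro card_ge_0_finite) (simp add: Coset.order_def)
  have pow: "\<exists>i. card H = p ^ i" if "additive_subgroup H R" for H
  proof -
    have "card H dvd p ^ k"
      using a_lagrange[OF fin that] k by (metis dvd_triv_right)
    then show ?thesis using divides_primepow_nat[OF p] by blast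
  qed
  define K where "K = {r \<in> carrier R. [p] \<cdot> r = \<zero>}"
  have K: "additive_subgroup K R" unfolding K_def by (rule torsion_additive_subgroup)
  have Rsub: "additive_subgroup (carrier R) R"
    by (rule additive_subgroupI) (rule add.subgroup_self)
  have Int: "\<exists>d. \<forall>I. ideal I R \<longrightarrow> card (I \<inter> H) = p ^ d I" if H: "additive_subgroup H R" for H
  proof -
    have "additive_subgroup (I \<inter> H) R" if "ideal I R" for I
      using add.subgroups_Inter_pair[of I H] additive_subgroup.a_subgroup[OF H]
        additive_subgroup.a_subgroup[OF ideal.axioms(1)[OF that]] by (intro additive_subgroupI)
    then have "\<forall>I. \<exists>i. ideal I R \<longrightarrow> card (I \<inter> H) = p ^ i" using pow by blast
    then show ?thesis by (rule choice)
  qed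
  obtain c where c: "\<And>I. ideal I R \<Longrightarrow> card (I \<inter> K) = p ^ c I"
    using Int[OF K] by blast
  \<comment> \<open>These exponents serve to show that the spline module has p-power order; those
    for \<open>K\<close> give its rank.\<close>
  obtain cR where cR: "\<And>I. ideal I R \<Longrightarrow> card (I \<inter> carrier R) = p ^ cR I"
    using Int[OF Rsub] by blast
  obtain d where d: "card K = p ^ d" using pow[OF K] by blast
  \<comment> \<open>Stated for any additive subgroup \<open>H\<close>: \<open>carrier R\<close>
    gives the order of the module, \<open>K\<close> that of its p-torsion.\<close>
  have card: "card (labelings H (\<lambda>I a b. a \<ominus> b \<in> I) (dyck_tree w)) = card H * p ^ open_weight c w"
    if "additive_subgroup H R" "\<And>I. ideal I R \<Longrightarrow> card (I \<inter> H) = p ^ c I" "w \<in> dyck {I. ideal I R}"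
    for H w and c :: "'a set \<Rightarrow> nat"
  proof (rule card_labelings[OF tree_of_word_dyck_tree[OF that(3)]])
    show "finite H" using additive_subgroup.a_subset[OF that(1)] fin by (rule finite_subset)
    fix I r assume "Open I \<in> set w" and r: "r \<in> H"
    then have I: "ideal I R" using dyck_Open_mem[OF that(3)] by blast
    show "card {s \<in> H. r \<ominus> s \<in> I} = p ^ c I"
      using card_coset_Int[OF that(1) ideal.axioms(1)[OF I] r] that(2)[OF I] by simp
  qed
  show ?thesis
  proof (intro exI ballI)
    fix w assume w: "w \<in> dyck {I. ideal I R}"
    let ?M = "Spl R (dyck_tree w)"
    have "Module.module R ?M"
      using edges_dyck_tree_mem[OF w] by (intro Spl_module is_cring) auto
    then interpret M: comm_group "add_monoid ?M"
      by (intro abelian_group.a_comm_group module.axioms(2))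
    have "Coset.order (add_monoid ?M) = p ^ (k + open_weight cR w)"
      using card[OF Rsub cR w] k by (simp add: Coset.order_def Spl_carrier power_add)
    moreover have "card {x \<in> carrier (add_monoid ?M). pow (add_monoid ?M) x p = \<one>\<^bsub>add_monoid ?M\<^esub>}
        = p ^ (d + open_weight c w)"
      using card[OF K c w] Spl_torsion[of "dyck_tree w" p] d by (simp add: K_def power_add)
    ultimately show "rank_Z ?M = d + open_weight c w"
      using M.least_generating_set[OF p] by (simp add: rank_Z_def)
  qed
qed

theorem theorem4p7:
  fixes R :: "('a, 'm) ring_scheme" and p :: nat
  assumes "cring R"
    and "finite (carrier R)"
    and "Factorial_Ring.prime p"
    and "\<exists>k. Coset.order R = p ^ k"
  shows "algebraic_fps (HD R)"
proof -
  interpret cring R by fact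
  let ?S = "{I. ideal I R}"
  have "?S \<subseteq> Pow (carrier R)"
    using additive_subgroup.a_subset ideal.axioms(1) by blast
  then have S: "finite ?S" "?S \<noteq> {}"
    using assms(2) finite_subset oneideal by blast+
  obtain d c where dc: "\<And>w. w \<in> dyck ?S \<Longrightarrow> rank_Z (Spl R (dyck_tree w)) = d + open_weight c w"
    using assms(3,4) rank_Spl by metis
  \<comment> \<open>The constant part \<open>d\<close> of the rank is counted once per word; the
    remainder is the edge weight.\<close>
  have "HD R = of_nat d * dyck_fps ?S + weight_fps c ?S"
  proof (rule fps_ext)
    fix n
    have "fps_nth (HD R) n = (\<Sum>w\<in>dyck_words ?S n. of_nat (rank_Z (Spl R (dyck_tree w))))"
      by (simp add: HD_def dyck_words_def)
    also have "\<dots> = (\<Sum>w\<in>dyck_words ?S n. of_nat d + of_nat (open_weight c w))"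
      by (intro sum.cong) (auto simp: dyck_words_def dc)
    finally show "fps_nth (HD R) n = fps_nth (of_nat d * dyck_fps ?S + weight_fps c ?S) n"
      by (simp add: sum.distrib fps_of_nat_mult_nth dyck_fps_def weight_fps_def mult.commute)
  qed
  then show ?thesis using algebraic_fps_weight[OF S] by simp
qed

end
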